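(* Let $0<\eta<1$. Consider the overset domain problem $$\partial_t\mathbf u+\vec\nabla_x\cdot\mathbf f(\mathbf u)+\mathcal L^b\big[\vec{\mathcal P}_u(\mathbf u,\mathbf v)\cdot\hat n_b\big]+\mathcal L^c\big[\vec{\mathcal P}_u(\mathbf u,\mathbf v)\cdot\hat n_c\big]=0,\quad \vec x\in\Omega_u,$$ $$\partial_t\mathbf v+\vec\nabla_x\cdot\mathbf f(\mathbf v)+\mathcal L^b\big[\vec{\mathcal P}_v(\mathbf u,\mathbf v)\cdot\hat n_b\big]+\mathcal L^c\big[\vec{\mathcal P}_v(\mathbf u,\mathbf v)\cdot\hat n_c\big]=0,\quad \vec x\in\Omega_v,$$ where the components of $\vec{\mathcal P}_u=\sum_{i=1}^d\mathcal P_{i,u}\hat x_i$ and $\vec{\mathcal P}_v=\sum_{i=1}^d\mathcal P_{i,v}\hat x_i$ are $$\mathcal P_{i,u}(\mathbf u,\mathbf v)=\beta\big(\mathbf f_i^{ec}(\mathbf u,\mathbf v)-\mathbf f_i(\mathbf u)\big),\qquad \mathcal P_{i,v}(\mathbf u,\mathbf v)=-\beta\big(\mathbf f_i^{ec}(\mathbf u,\mathbf v)-\mathbf f_i(\mathbf v)\big),$$ with $\beta=-\eta$ on $\Gamma_b$ and $\beta=1-\eta$ on $\Gamma_c$, and where, for each $i=1,\dots,d$, $\mathbf f_i^{ec}$ is an entropy conserving flux for the $i$-th coordinate direction, satisfying the Tadmor jump condition $$f_i^\epsilon(\mathbf u)-f_i^\epsilon(\mathbf v)=\mathbf w(\mathbf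 u)^T\mathbf f_i(\mathbf u)-\mathbf w(\mathbf v)^T\mathbf f_i(\mathbf v)-\big(\mathbf w(\mathbf u)-\mathbf w(\mathbf v)\big)^T\mathbf f_i^{ec}(\mathbf u,\mathbf v)$$ for all admissible states $\mathbf u,\mathbf v$. Then the overset domain problem is entropy conserving and conservative (in the senses defined in the context).
   Context: **Conservation law and entropy.** $\partial_t\boldsymbol\omega+\vec\nabla_x\cdot\mathbf f(\boldsymbol\omega)=0$ on $\Omega\subset\mathbb R^d$ is a system of $p$ conservation laws with flux $\mathbf f=\sum_{i=1}^d\mathbf f_i(\boldsymbol\omega)\hat x_i$, $\mathbf f_i(\boldsymbol\omega)\in\mathbb R^p$. It has an entropy pair $(s,\vec f^{\,\epsilon})$: $s$ is a convex scalar function of the state, $\vec f^{\,\epsilon}=(f^\epsilon_1,\dots,f^\epsilon_d)$ is the entropy flux, and with the entropy variables $\mathbf w(\boldsymbol\omega)=\partial s/\partial\boldsymbol\omega$ one has, for smooth states, $\mathbf w^T\partial_t\boldsymbol\omega=\partial_t s(\boldsymbol\omega)$ and $\mathbf w^T\,\vec\nabla_x\cdot\mathbf f=\vec\nabla_x\cdot\vec f^{\,\epsilon}$. An entropy conserving flux $\mathbf f_i^{ec}(\mathbf u,\mathbf v)\in\mathbb R^p$ is a two-point flux that satisfies the Tadmor jump condition and is consistent, $\mathbf f_i^{ec}(\mathbf u,\mathbf u)=\mathbf f_i(\mathbf u)$. **Geometry.** $\Omega=\Omega_u\cup\Omega_v$, where the overset domain $\Omega_u$ and the base domain $\Omega_v$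 overlap in $\Omega_O=\Omega_u\cap\Omega_v$. Put $\Omega_{\bar u}=\Omega_u\setminus\Omega_O$ and $\Omega_{\bar v}=\Omega_v\setminus\Omega_O$. The physical boundary of $\Omega$ is $\Gamma_a\cup\Gamma_d$. The boundary of $\Omega_u$ is $\Gamma_a\cup\Gamma_c$ and that of $\Omega_v$ is $\Gamma_b\cup\Gamma_d$, where $\Gamma_b,\Gamma_c$ are artificial interfaces. Thus $\partial\Omega_{\bar u}=\Gamma_a\cup\Gamma_b$, $\partial\Omega_O=\Gamma_b\cup\Gamma_c$, $\partial\Omega_{\bar v}=\Gamma_c\cup\Gamma_d$. The unit normals $\hat n_a,\hat n_c$ point out of $\Omega_u$ and $\hat n_b,\hat n_d$ point out of $\Omega_v$. **Lifting operator and penalties.** $\mathcal L^\alpha$, $\alpha\in\{b,c\}$, is the lifting operator, defined weakly by $\int\boldsymbol\psi^T\mathcal L^\alpha[\mathbf q]\,dV=\int_{\Gamma_\alpha}\boldsymbol\psi^T\mathbf q\,dS$ for test functions $\boldsymbol\psi$. On $\Gamma_\alpha$ write $\mathcal P_u=\vec{\mathcal P}_u\cdot\hat n_\alpha=\sum_i\mathcal P_{i,u}\,(\hat n_\alpha)_i\in\mathbb R^p$, and similarly $\mathcal P_v$. Put $\vec\beta=\beta\,\hat n_\alpha$, i.e. $\vec\beta=-\eta\,\hat n_b$ on $\Gamma_b$ and $\vec\beta=(1-\eta)\,\hat n_c$ on $\Gamma_c$. **Entropy conserving.** The overset problem is called entropy conserving (entropy preserving) if on each of $\Gamma_b$ and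 $\Gamma_c$ $$\big(\vec f^{\,\epsilon}(\mathbf u)-\vec f^{\,\epsilon}(\mathbf v)\big)\cdot\vec\beta+\mathbf w(\mathbf u)^T\mathcal P_u+\mathbf w(\mathbf v)^T\mathcal P_v=0.$$ The expression on the left is the interface contribution in the balance for the total entropy $\bar S=\int_\Omega S\,d\vec x$, where $S=s(\mathbf u)$ on $\Omega_{\bar u}$, $S=(1-\eta)s(\mathbf u)+\eta s(\mathbf v)$ on $\Omega_O$ and $S=s(\mathbf v)$ on $\Omega_{\bar v}$; when it vanishes, only the physical boundary entropy fluxes through $\Gamma_a$ and $\Gamma_d$ remain in that balance. **Conservative.** The overset problem is called conservative if on each of $\Gamma_b$ and $\Gamma_c$ $$\big(\mathbf f(\mathbf u)-\mathbf f(\mathbf v)\big)\cdot\vec\beta+\mathcal P_u+\mathcal P_v=0,\qquad\text{where }\mathbf f\cdot\vec\beta=\sum_i\mathbf f_i\,\beta_i .$$ The expression on the left is the interface contribution in the balance for $\int_{\Omega_u}\mathbf u+\int_{\Omega_v}\mathbf v-\big\{\eta\int_{\Omega_O}\mathbf u+(1-\eta)\int_{\Omega_O}\mathbf v\big\}$; when it vanishes, only the physical boundary fluxes through $\Gamma_a$ and $\Gamma_d$ remain in that balance. *)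

theory Defs
  imports "HOL-Analysis.Analysis"
begin

section \<open>Surface measure, divergence, outward normals\<close>

text \<open>
  The surface measure dS on hypersurfaces of the d-dimensional space is the (d-1)-dimensional
  Hausdorff measure, normalised so that it agrees with the usual area on hyperplanes.  The
  empty set is given weight 0 explicitly, because a singleton must have weight
  \<open>0 ^ 0 = 1\<close> when \<open>k = 0\<close> (then one obtains counting measure).
\<close>

definition hausdorff_content :: "nat \<Rightarrow> real \<Rightarrow> 'a::metric_space set \<Rightarrow> ennreal" where
  "hausdorff_content k \<delta> A =
     (INF U \<in> {U :: nat \<Rightarrow> 'a set. A \<subseteq> (\<Union>n. U n) \<and> (\<forall>n. bounded (U n) \<and> diameter (U n) \<le> \<delta>)}.
        (\<Sum>n. ennreal (if U n = {} then 0 else diameter (U n) ^ k)))"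

definition hausdorff_outer :: "nat \<Rightarrow> 'a::metric_space set \<Rightarrow> ennreal" where
  "hausdorff_outer k A =
     ennreal (unit_ball_vol (real k) / 2 ^ k) * (SUP \<delta>\<in>{0<..}. hausdorff_content k \<delta> A)"

text \<open>
  Hausdorff outer measure is a metric outer measure, hence countably additive on Borel sets,
  so \<^const>\<open>measure_of\<close> does not degenerate to the null measure here.
\<close>

definition surface_measure :: "(real ^ 'd) measure" where
  "surface_measure = measure_of UNIV (sets borel) (hausdorff_outer (CARD('d) - 1))"

definition divergence ::
  "('d::finite \<Rightarrow> real ^ 'd \<Rightarrow> 'b::real_normed_vector) \<Rightarrow> real ^ 'd \<Rightarrow> 'b" where
  "divergence F x = (\<Sum>i\<in>UNIV. vector_derivative (\<lambda>h. F i (x + h *\<^sub>R axis i 1)) (at 0))"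

text \<open>
  A unit vector \<open>n\<close> is the outward unit normal of \<open>D\<close> at \<open>x\<close> if, near \<open>x\<close>, the set \<open>D\<close> agrees
  with the half space \<open>{y. (y - x) \<bullet> n < 0}\<close> outside every cone around the tangent plane.
\<close>

definition outward_unit_normal :: "'a::euclidean_space set \<Rightarrow> 'a \<Rightarrow> 'a \<Rightarrow> bool" where
  "outward_unit_normal D x n \<longleftrightarrow> norm n = 1 \<and>
     (\<forall>\<epsilon>>0. \<exists>\<delta>>0. \<forall>y\<in>ball x \<delta>.
        ((y - x) \<bullet> n > \<epsilon> * norm (y - x) \<longrightarrow> y \<notin> D) \<and>
        ((y - x) \<bullet> n < - \<epsilon> * norm (y - x) \<longrightarrow> y \<in> D))"


section \<open>Conservation laws and entropy\<close>

text \<open>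
  Here \<open>'d\<close> indexes the space directions and \<open>'p\<close> the components of the state.
  The set \<open>states\<close> consists of the admissible states.
\<close>

record ('d, 'p) conservation_law =
  states :: "(real ^ 'p) set"
  flux :: "'d \<Rightarrow> real ^ 'p \<Rightarrow> real ^ 'p"
  entropy :: "real ^ 'p \<Rightarrow> real"
  entropy_flux :: "'d \<Rightarrow> real ^ 'p \<Rightarrow> real"
  entropy_vars :: "real ^ 'p \<Rightarrow> real ^ 'p"

definition smooth_state ::
  "('d::finite, 'p::finite) conservation_law \<Rightarrow> (real \<Rightarrow> real ^ 'd \<Rightarrow> real ^ 'p) \<Rightarrow> bool" where
  "smooth_state cl \<omega> \<longleftrightarrow>
     (\<forall>t x. \<omega> t x \<in> states cl) \<and> (\<lambda>(t, x). \<omega> t x) differentiable_on UNIV"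

definition entropy_conservation_law :: "('d::finite, 'p::finite) conservation_law \<Rightarrow> bool" where
  "entropy_conservation_law cl \<longleftrightarrow>
     open (states cl) \<and>
     (\<forall>i. \<forall>\<omega>\<in>states cl. flux cl i differentiable (at \<omega>)) \<and>
     (\<forall>i. \<forall>\<omega>\<in>states cl. entropy_flux cl i differentiable (at \<omega>)) \<and>
     convex_on (states cl) (entropy cl) \<and>
     (\<forall>\<omega>\<in>states cl. GDERIV (entropy cl) \<omega> :> entropy_vars cl \<omega>) \<and>
     (\<forall>\<omega> t x. smooth_state cl \<omega> \<longrightarrow>
        entropy_vars cl (\<omega> t x) \<bullet> vector_derivative (\<lambda>\<tau>. \<omega> \<tau> x) (at t)
          = vector_derivative (\<lambda>\<tau>. entropy cl (\<omega> \<tau> x)) (at t) \<and>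
        entropy_vars cl (\<omega> t x) \<bullet> divergence (\<lambda>i y. flux cl i (\<omega> t y)) x
          = divergence (\<lambda>i y. entropy_flux cl i (\<omega> t y)) x)"

definition tadmor_condition ::
  "('d::finite, 'p::finite) conservation_law \<Rightarrow> 'd
     \<Rightarrow> (real ^ 'p \<Rightarrow> real ^ 'p \<Rightarrow> real ^ 'p) \<Rightarrow> bool" where
  "tadmor_condition cl i g \<longleftrightarrow>
     (\<forall>u\<in>states cl. \<forall>v\<in>states cl.
        entropy_flux cl i u - entropy_flux cl i v
          = entropy_vars cl u \<bullet> flux cl i u - entropy_vars cl v \<bullet> flux cl i v
            - (entropy_vars cl u - entropy_vars cl v) \<bullet> g u v)"

definition entropy_conserving_flux ::
  "('d::finite, 'p::finite) conservation_law \<Rightarrow> 'd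
     \<Rightarrow> (real ^ 'p \<Rightarrow> real ^ 'p \<Rightarrow> real ^ 'p) \<Rightarrow> bool" where
  "entropy_conserving_flux cl i g \<longleftrightarrow>
     tadmor_condition cl i g \<and> (\<forall>u\<in>states cl. g u u = flux cl i u)"


section \<open>Overset geometry\<close>

record 'd overset_geometry =
  Omega_u :: "(real ^ 'd) set"
  Omega_v :: "(real ^ 'd) set"
  Gamma_a :: "(real ^ 'd) set"
  Gamma_b :: "(real ^ 'd) set"
  Gamma_c :: "(real ^ 'd) set"
  Gamma_d :: "(real ^ 'd) set"
  normal_a :: "real ^ 'd \<Rightarrow> real ^ 'd"
  normal_b :: "real ^ 'd \<Rightarrow> real ^ 'd"
  normal_c :: "real ^ 'd \<Rightarrow> real ^ 'd"
  normal_d :: "real ^ 'd \<Rightarrow> real ^ 'd"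

definition normal_field ::
  "(real ^ 'd) set \<Rightarrow> (real ^ 'd) set \<Rightarrow> (real ^ 'd \<Rightarrow> real ^ 'd::finite) \<Rightarrow> bool" where
  "normal_field D \<Gamma> n \<longleftrightarrow> (AE x in surface_measure. x \<in> \<Gamma> \<longrightarrow> outward_unit_normal D x (n x))"

definition wf_geometry :: "'d::finite overset_geometry \<Rightarrow> bool" where
  "wf_geometry G \<longleftrightarrow>
     (let Ou = Omega_u G; Ov = Omega_v G; Oo = Ou \<inter> Ov;
          Ga = Gamma_a G; Gb = Gamma_b G; Gc = Gamma_c G; Gd = Gamma_d G
      in open Ou \<and> open Ov \<and> Oo \<noteq> {} \<and>
         {Ga, Gb, Gc, Gd} \<subseteq> sets borel \<and>
         frontier (Ou \<union> Ov) = Ga \<union> Gd \<and>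
         frontier Ou = Ga \<union> Gc \<and> frontier Ov = Gb \<union> Gd \<and>
         frontier (Ou - Oo) = Ga \<union> Gb \<and>
         frontier Oo = Gb \<union> Gc \<and>
         frontier (Ov - Oo) = Gc \<union> Gd \<and>
         normal_field Ou Ga (normal_a G) \<and> normal_field Ov Gb (normal_b G) \<and>
         normal_field Ou Gc (normal_c G) \<and> normal_field Ov Gd (normal_d G))"

datatype interface = If_b | If_c

fun Gamma :: "'d::finite overset_geometry \<Rightarrow> interface \<Rightarrow> (real ^ 'd) set" where
  "Gamma G If_b = Gamma_b G"
| "Gamma G If_c = Gamma_c G"

fun normal :: "'d::finite overset_geometry \<Rightarrow> interface \<Rightarrow> real ^ 'd \<Rightarrow> real ^ 'd" where
  "normal G If_b = normal_b G"
| "normal G If_c = normal_c G"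

fun beta :: "real \<Rightarrow> interface \<Rightarrow> real" where
  "beta \<eta> If_b = - \<eta>"
| "beta \<eta> If_c = 1 - \<eta>"


section \<open>The overset domain problem\<close>

text \<open>
  The penalties \<open>pen_u\<close>, \<open>pen_v\<close> take the interface, the space direction and the two states.
  The set \<open>tests\<close> of test functions is a parameter of the problem (all smooth functions for
  the continuous problem, a finite-dimensional space for a Galerkin approximation), as is the
  set \<open>times\<close> of times at which the equations are posed.
\<close>

record ('d, 'p) overset_problem =
  law :: "('d, 'p) conservation_law"
  geometry :: "'d overset_geometry"
  eta :: real
  pen_u :: "interface \<Rightarrow> 'd \<Rightarrow> real ^ 'p \<Rightarrow> real ^ 'p \<Rightarrow> real ^ 'p"
  pen_v :: "interface \<Rightarrow> 'd \<Rightarrow> real ^ 'p \<Rightarrow> real ^ 'p \<Rightarrow> real ^ 'p"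
  tests :: "(real ^ 'd \<Rightarrow> real ^ 'p) set"
  times :: "real set"

definition wf_overset_problem :: "('d::finite, 'p::finite) overset_problem \<Rightarrow> bool" where
  "wf_overset_problem pb \<longleftrightarrow>
     entropy_conservation_law (law pb) \<and> wf_geometry (geometry pb) \<and> open (times pb)"

definition normal_pen ::
  "('d::finite, 'p::finite) overset_problem
     \<Rightarrow> (interface \<Rightarrow> 'd \<Rightarrow> real ^ 'p \<Rightarrow> real ^ 'p \<Rightarrow> real ^ 'p)
     \<Rightarrow> interface \<Rightarrow> real ^ 'd \<Rightarrow> real ^ 'p \<Rightarrow> real ^ 'p \<Rightarrow> real ^ 'p" where
  "normal_pen pb P \<alpha> x u v = (\<Sum>i\<in>UNIV. (normal (geometry pb) \<alpha> x $ i) *\<^sub>R P \<alpha> i u v)"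

text \<open>
  The lifting operator yields a distribution supported on the interface (it is not a function
  unless the test space is finite-dimensional), so it is represented by its action on
  test functions.
\<close>

definition lift ::
  "'d::finite overset_geometry \<Rightarrow> interface \<Rightarrow> (real ^ 'd \<Rightarrow> real ^ 'p::finite)
     \<Rightarrow> (real ^ 'd \<Rightarrow> real ^ 'p) \<Rightarrow> real" where
  "lift G \<alpha> q \<psi> = set_lebesgue_integral surface_measure (Gamma G \<alpha>) (\<lambda>x. \<psi> x \<bullet> q x)"

definition liftable ::
  "'d::finite overset_geometry \<Rightarrow> interface \<Rightarrow> (real ^ 'd \<Rightarrow> real ^ 'p::finite)
     \<Rightarrow> (real ^ 'd \<Rightarrow> real ^ 'p) \<Rightarrow> bool" where
  "liftable G \<alpha> q \<psi> \<longleftrightarrow> set_integrable surface_measure (Gamma G \<alpha>) (\<lambda>x. \<psi> x \<bullet> q x)"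

definition residual ::
  "('d::finite, 'p::finite) conservation_law \<Rightarrow> (real \<Rightarrow> real ^ 'd \<Rightarrow> real ^ 'p)
     \<Rightarrow> real \<Rightarrow> real ^ 'd \<Rightarrow> real ^ 'p" where
  "residual cl \<omega> t x =
     vector_derivative (\<lambda>\<tau>. \<omega> \<tau> x) (at t) + divergence (\<lambda>i y. flux cl i (\<omega> t y)) x"

text \<open>
  \<open>admissible_field cl T D \<omega>\<close>: a differentiable field on \<open>D\<close> with traces on the frontier of
  \<open>D\<close>, the traces being the values on \<open>closure D\<close>.
\<close>

definition admissible_field ::
  "('d::finite, 'p::finite) conservation_law \<Rightarrow> real set \<Rightarrow> (real ^ 'd) set
     \<Rightarrow> (real \<Rightarrow> real ^ 'd \<Rightarrow> real ^ 'p) \<Rightarrow> bool" where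
  "admissible_field cl T D \<omega> \<longleftrightarrow>
     (\<forall>t\<in>T. continuous_on (closure D) (\<omega> t) \<and>
        (\<forall>x\<in>closure D. \<omega> t x \<in> states cl) \<and>
        (\<forall>x\<in>D. (\<lambda>\<tau>. \<omega> \<tau> x) differentiable (at t) \<and> \<omega> t differentiable (at x)))"

text \<open>
  The equation \<open>\<partial>\<^sub>t \<omega> + div f(\<omega>) + L\<^sup>b[q b] + L\<^sup>c[q c] = 0\<close> on \<open>D\<close>, tested with all
  test functions; \<open>q \<alpha>\<close> is the lifted quantity at time \<open>t\<close>.
\<close>

definition satisfies_pde ::
  "('d::finite, 'p::finite) overset_problem \<Rightarrow> (real ^ 'd) set
     \<Rightarrow> (real \<Rightarrow> real ^ 'd \<Rightarrow> real ^ 'p) \<Rightarrow> real \<Rightarrow> (interface \<Rightarrow> real ^ 'd \<Rightarrow> real ^ 'p) \<Rightarrow> bool" where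
  "satisfies_pde pb D \<omega> t q \<longleftrightarrow>
     (\<forall>\<psi>\<in>tests pb.
        set_integrable lborel D (\<lambda>x. \<psi> x \<bullet> residual (law pb) \<omega> t x) \<and>
        (\<forall>\<alpha>. liftable (geometry pb) \<alpha> (q \<alpha>) \<psi>) \<and>
        set_lebesgue_integral lborel D (\<lambda>x. \<psi> x \<bullet> residual (law pb) \<omega> t x)
          + lift (geometry pb) If_b (q If_b) \<psi> + lift (geometry pb) If_c (q If_c) \<psi> = 0)"

definition overset_solution ::
  "('d::finite, 'p::finite) overset_problem \<Rightarrow> (real \<Rightarrow> real ^ 'd \<Rightarrow> real ^ 'p)
     \<Rightarrow> (real \<Rightarrow> real ^ 'd \<Rightarrow> real ^ 'p) \<Rightarrow> bool" where
  "overset_solution pb u v \<longleftrightarrow>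
     admissible_field (law pb) (times pb) (Omega_u (geometry pb)) u \<and>
     admissible_field (law pb) (times pb) (Omega_v (geometry pb)) v \<and>
     (\<forall>t\<in>times pb.
        satisfies_pde pb (Omega_u (geometry pb)) u t
          (\<lambda>\<alpha> x. normal_pen pb (pen_u pb) \<alpha> x (u t x) (v t x)) \<and>
        satisfies_pde pb (Omega_v (geometry pb)) v t
          (\<lambda>\<alpha> x. normal_pen pb (pen_v pb) \<alpha> x (u t x) (v t x)))"

definition beta_vec ::
  "('d::finite, 'p::finite) overset_problem \<Rightarrow> interface \<Rightarrow> real ^ 'd \<Rightarrow> real ^ 'd" where
  "beta_vec pb \<alpha> x = beta (eta pb) \<alpha> *\<^sub>R normal (geometry pb) \<alpha> x"

definition entropy_conserving :: "('d::finite, 'p::finite) overset_problem \<Rightarrow> bool" where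
  "entropy_conserving pb \<longleftrightarrow>
     (\<forall>u v. overset_solution pb u v \<longrightarrow>
        (\<forall>t\<in>times pb. \<forall>\<alpha>. \<forall>x\<in>Gamma (geometry pb) \<alpha>.
           (\<Sum>i\<in>UNIV. (entropy_flux (law pb) i (u t x) - entropy_flux (law pb) i (v t x))
                        * (beta_vec pb \<alpha> x $ i))
           + entropy_vars (law pb) (u t x) \<bullet> normal_pen pb (pen_u pb) \<alpha> x (u t x) (v t x)
           + entropy_vars (law pb) (v t x) \<bullet> normal_pen pb (pen_v pb) \<alpha> x (u t x) (v t x) = 0))"

definition conservative :: "('d::finite, 'p::finite) overset_problem \<Rightarrow> bool" where
  "conservative pb \<longleftrightarrow>
     (\<forall>u v. overset_solution pb u v \<longrightarrow>
        (\<forall>t\<in>times pb. \<forall>\<alpha>. \<forall>x\<in>Gamma (geometry pb) \<alpha>.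
           (\<Sum>i\<in>UNIV. (beta_vec pb \<alpha> x $ i)
                        *\<^sub>R (flux (law pb) i (u t x) - flux (law pb) i (v t x)))
           + normal_pen pb (pen_u pb) \<alpha> x (u t x) (v t x)
           + normal_pen pb (pen_v pb) \<alpha> x (u t x) (v t x) = 0))"

end

theory Submission
  imports Defs
begin

text \<open>
  At a point of \<open>\<Gamma>\<^sub>b\<close> or \<open>\<Gamma>\<^sub>c\<close> both interface contributions are sums over the space directions,
  and every summand vanishes separately; the common factor \<open>\<beta> n\<^sub>i\<close> comes out.  For conservation
  the bracket is \<open>(f\<^sub>i(u) - f\<^sub>i(v)) + (f\<^sub>i\<^sup>e\<^sup>c - f\<^sub>i(u)) - (f\<^sub>i\<^sup>e\<^sup>c - f\<^sub>i(v)) = 0\<close>: both penalties use the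
  same two-point flux, with opposite signs.  For the entropy,
  contracting the two penalties with \<open>w(u)\<close> and \<open>w(v)\<close> leaves
  \<open>(w(u) - w(v)) \<bullet> f\<^sub>i\<^sup>e\<^sup>c - w(u) \<bullet> f\<^sub>i(u) + w(v) \<bullet> f\<^sub>i(v)\<close>, which the Tadmor condition says is exactly
  minus the jump of the entropy flux.

  The Tadmor condition and the formulas for the penalties hold only for admissible states.  The
  geometry supplies these: each interface bounds the overlap, so it lies in the closure of both
  subdomains, where both fields have admissible traces.
\<close>

lemma interface_subset_closures:
  assumes "wf_geometry G"
  shows "Gamma G \<alpha> \<subseteq> closure (Omega_u G) \<inter> closure (Omega_v G)"
proof -
  have "Gamma G \<alpha> \<subseteq> Gamma_b G \<union> Gamma_c G"
    by (cases \<alpha>) auto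
  also have "\<dots> = frontier (Omega_u G \<inter> Omega_v G)"
    using assms by (auto simp: wf_geometry_def Let_def)
  also have "\<dots> \<subseteq> closure (Omega_u G \<inter> Omega_v G)"
    by (auto simp: frontier_def)
  also have "\<dots> \<subseteq> closure (Omega_u G) \<inter> closure (Omega_v G)"
    by (simp add: closure_mono)
  finally show ?thesis .
qed

lemma interface_traces_admissible:
  assumes "wf_overset_problem pb" and "overset_solution pb u v"
    and "t \<in> times pb" and "x \<in> Gamma (geometry pb) \<alpha>"
  shows "u t x \<in> states (law pb)" and "v t x \<in> states (law pb)"
proof -
  have "x \<in> closure (Omega_u (geometry pb)) \<inter> closure (Omega_v (geometry pb))"
    using interface_subset_closures assms(1,4) unfolding wf_overset_problem_def by blast
  then show "u t x \<in> states (law pb)" and "v t x \<in> states (law pb)"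
    using assms(2,3) by (auto simp: overset_solution_def admissible_field_def)
qed

text \<open>
  Both penalties weight a direction by the same component \<open>n\<^sub>i\<close> of the normal as \<open>\<beta> n\<close> does, so it
  suffices to check a cancellation direction by direction.
\<close>

lemma entropy_interface_term_eq_0:
  fixes pb :: "('d::finite, 'p::finite) overset_problem"
  assumes tadmor: "\<And>i. tadmor_condition (law pb) i (g i)"
    and states: "u \<in> states (law pb)" "v \<in> states (law pb)"
    and pen_u: "\<And>i. pen_u pb \<alpha> i u v = beta (eta pb) \<alpha> *\<^sub>R (g i u v - flux (law pb) i u)"
    and pen_v: "\<And>i. pen_v pb \<alpha> i u v = - beta (eta pb) \<alpha> *\<^sub>R (g i u v - flux (law pb) i v)"
  shows "(\<Sum>i\<in>UNIV. (entropy_flux (law pb) i u - entropy_flux (law pb) i v) * (beta_vec pb \<alpha> x $ i))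
      + entropy_vars (law pb) u \<bullet> normal_pen pb (pen_u pb) \<alpha> x u v
      + entropy_vars (law pb) v \<bullet> normal_pen pb (pen_v pb) \<alpha> x u v = 0"
proof -
  let ?w = "entropy_vars (law pb)"
  let ?b = "beta (eta pb) \<alpha>" and ?n = "normal (geometry pb) \<alpha> x"
  have "(entropy_flux (law pb) i u - entropy_flux (law pb) i v) * (?b * ?n $ i)
      + ?w u \<bullet> (?n $ i *\<^sub>R pen_u pb \<alpha> i u v) + ?w v \<bullet> (?n $ i *\<^sub>R pen_v pb \<alpha> i u v) = 0" for i
  proof -
    have jump: "entropy_flux (law pb) i u - entropy_flux (law pb) i v
        = ?w u \<bullet> flux (law pb) i u - ?w v \<bullet> flux (law pb) i v - (?w u - ?w v) \<bullet> g i u v"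
      using tadmor states unfolding tadmor_condition_def by blast
    show ?thesis
      unfolding jump pen_u pen_v
      by (simp add: inner_diff_left inner_diff_right algebra_simps)
  qed
  then show ?thesis
    by (simp add: normal_pen_def beta_vec_def inner_sum_right flip: sum.distrib)
qed

lemma conservation_interface_term_eq_0:
  fixes pb :: "('d::finite, 'p::finite) overset_problem"
  assumes pen_u: "\<And>i. pen_u pb \<alpha> i u v = beta (eta pb) \<alpha> *\<^sub>R (g i u v - flux (law pb) i u)"
    and pen_v: "\<And>i. pen_v pb \<alpha> i u v = - beta (eta pb) \<alpha> *\<^sub>R (g i u v - flux (law pb) i v)"
  shows "(\<Sum>i\<in>UNIV. (beta_vec pb \<alpha> x $ i) *\<^sub>R (flux (law pb) i u - flux (law pb) i v))
      + normal_pen pb (pen_u pb) \<alpha> x u v + normal_pen pb (pen_v pb) \<alpha> x u v = 0"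
  unfolding normal_pen_def beta_vec_def pen_u pen_v sum.distrib[symmetric]
  by (rule sum.neutral) (simp add: algebra_simps)

theorem theorem2:
  fixes pb :: "('d::finite, 'p::finite) overset_problem"
    and fec :: "'d \<Rightarrow> real ^ 'p \<Rightarrow> real ^ 'p \<Rightarrow> real ^ 'p"
  assumes "wf_overset_problem pb"
    and "0 < eta pb" and "eta pb < 1"
    and "\<And>i. entropy_conserving_flux (law pb) i (fec i)"
    and "\<And>\<alpha> i u v. u \<in> states (law pb) \<Longrightarrow> v \<in> states (law pb) \<Longrightarrow>
           pen_u pb \<alpha> i u v = beta (eta pb) \<alpha> *\<^sub>R (fec i u v - flux (law pb) i u)"
    and "\<And>\<alpha> i u v. u \<in> states (law pb) \<Longrightarrow> v \<in> states (law pb) \<Longrightarrow>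
           pen_v pb \<alpha> i u v = - beta (eta pb) \<alpha> *\<^sub>R (fec i u v - flux (law pb) i v)"
  shows "entropy_conserving pb \<and> conservative pb"
proof
  note traces = interface_traces_admissible[OF assms(1)]
  have tadmor: "tadmor_condition (law pb) i (fec i)" for i
    using assms(4) by (simp add: entropy_conserving_flux_def)
  show "entropy_conserving pb"
    unfolding entropy_conserving_def
    by (intro allI impI ballI entropy_interface_term_eq_0[where g = fec])
      (use tadmor traces assms(5,6) in blast)+
  show "conservative pb"
    unfolding conservative_def
    by (intro allI impI ballI conservation_interface_term_eq_0[where g = fec])
      (use traces assms(5,6) in blast)+
qed

end
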